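(* Let $\alpha$ be a Sturm number with $0<\alpha<1$. Then $s_{\alpha,0}$ is a fixed point of some $\psi\in\mathcal{M}_{3,8}$. Conversely, every $\psi\in\mathcal{M}_{3,8}\setminus(\mathcal{M}_3\cup\mathcal{M}_8)$ fixes $s_{\alpha,0}$ for some $\alpha$. The same two statements hold for $s'_{\alpha,0}$ in place of $s_{\alpha,0}$, with $\mathcal{M}_{3,8}$, $\mathcal{M}_3$, $\mathcal{M}_8$ replaced by $\mathcal{M}_{4,7}$, $\mathcal{M}_4$, $\mathcal{M}_7$ respectively.
   Context: For irrational $0<\alpha<1$ and real $\rho$: $s_{\alpha,\rho}(n)=\lfloor (n+1)\alpha+\rho\rfloor-\lfloor n\alpha+\rho\rfloor$ and $s'_{\alpha,\rho}(n)=\lceil (n+1)\alpha+\rho\rceil-\lceil n\alpha+\rho\rceil$, $n\ge 0$, and $c_\alpha=s_{\alpha,\alpha}$ (so $s_{\alpha,0}=0c_\alpha$, $s'_{\alpha,0}=1c_\alpha$). A Sturm number is an irrational $\alpha\in(0,1)$ such that $c_\alpha$ is a fixed point of some morphism of $\{0,1\}^*$ other than the identity. Morphisms of $\{0,1\}^*$: $\psi_3: 0\mapsto 0,\ 1\mapsto 01$; $\psi_4: 0\mapsto 0,\ 1\mapsto 10$; $\psi_7: 0\mapsto 10,\ 1\mapsto 1$; $\psi_8: 0\mapsto 01,\ 1\mapsto 1$. $\mathcal{M}_{i,j}$ is the monoid under composition generated by $\psi_i,\psi_j$, and $\mathcal{M}_i=\{\psi_i^n:n\ge 0\}$. *)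

theory Defs
  imports Complex_Main "HOL-Library.Omega_Words_Fun"
begin

datatype letter = Zero | One

text \<open>
  The differences of floors and ceilings below only take the values 0 and 1 when
  \<open>0 < \<alpha> < 1\<close>; see \<open>floor_diff\<close> and \<open>ceiling_diff\<close>.
\<close>

definition letter_of_int :: "int \<Rightarrow> letter" where
  "letter_of_int k = (if k = 0 then Zero else One)"

definition s :: "real \<Rightarrow> real \<Rightarrow> letter word" where
  "s \<alpha> \<rho> n = letter_of_int (\<lfloor>real (n + 1) * \<alpha> + \<rho>\<rfloor> - \<lfloor>real n * \<alpha> + \<rho>\<rfloor>)"

definition s' :: "real \<Rightarrow> real \<Rightarrow> letter word" where
  "s' \<alpha> \<rho> n = letter_of_int (\<lceil>real (n + 1) * \<alpha> + \<rho>\<rceil> - \<lceil>real n * \<alpha> + \<rho>\<rceil>)"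

lemma floor_diff:
  fixes \<alpha> \<rho> :: real
  assumes "0 < \<alpha>" "\<alpha> < 1"
  shows "\<lfloor>real (n + 1) * \<alpha> + \<rho>\<rfloor> - \<lfloor>real n * \<alpha> + \<rho>\<rfloor> \<in> {0, 1}"
proof -
  have "real (n + 1) * \<alpha> + \<rho> = (real n * \<alpha> + \<rho>) + \<alpha>"
    by (simp add: algebra_simps)
  moreover have "\<lfloor>x\<rfloor> \<le> \<lfloor>x + \<alpha>\<rfloor> \<and> \<lfloor>x + \<alpha>\<rfloor> \<le> \<lfloor>x\<rfloor> + 1" for x
    using assms by linarith
  ultimately show ?thesis
    by (smt (verit) insertCI)
qed

lemma ceiling_diff:
  fixes \<alpha> \<rho> :: real
  assumes "0 < \<alpha>" "\<alpha> < 1"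
  shows "\<lceil>real (n + 1) * \<alpha> + \<rho>\<rceil> - \<lceil>real n * \<alpha> + \<rho>\<rceil> \<in> {0, 1}"
proof -
  have "real (n + 1) * \<alpha> + \<rho> = (real n * \<alpha> + \<rho>) + \<alpha>"
    by (simp add: algebra_simps)
  moreover have "\<lceil>x\<rceil> \<le> \<lceil>x + \<alpha>\<rceil> \<and> \<lceil>x + \<alpha>\<rceil> \<le> \<lceil>x\<rceil> + 1" for x
    using assms by linarith
  ultimately show ?thesis
    by (smt (verit) insertCI)
qed

definition c :: "real \<Rightarrow> letter word" where
  "c \<alpha> = s \<alpha> \<alpha>"

definition morphism :: "(letter list \<Rightarrow> letter list) \<Rightarrow> bool" where
  "morphism f \<longleftrightarrow> f [] = [] \<and> (\<forall>u v. f (u @ v) = f u @ f v)"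

text \<open>
  \<open>is_image f x y\<close>: the image of the infinite word \<open>x = x\<^sub>0 x\<^sub>1 x\<^sub>2 \<dots>\<close> under the
  morphism \<open>f\<close>, that is the concatenation \<open>f(x\<^sub>0) f(x\<^sub>1) f(x\<^sub>2) \<dots>\<close>, is the infinite word \<open>y\<close>.
  Morphisms may erase letters, hence the requirement that this concatenation be infinite.
\<close>

definition is_image :: "(letter list \<Rightarrow> letter list) \<Rightarrow> letter word \<Rightarrow> letter word \<Rightarrow> bool" where
  "is_image f x y \<longleftrightarrow>
     (\<forall>n. \<exists>m. f (prefix n x) = prefix m y) \<and>
     filterlim (\<lambda>n. length (f (prefix n x))) at_top sequentially"

definition fixes_word :: "(letter list \<Rightarrow> letter list) \<Rightarrow> letter word \<Rightarrow> bool" where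
  "fixes_word f x \<longleftrightarrow> is_image f x x"

definition Sturm_number :: "real \<Rightarrow> bool" where
  "Sturm_number \<alpha> \<longleftrightarrow>
     \<alpha> \<notin> \<rat> \<and> 0 < \<alpha> \<and> \<alpha> < 1 \<and> (\<exists>f. morphism f \<and> f \<noteq> id \<and> fixes_word f (c \<alpha>))"

text \<open>The morphism given by the images of the two letters.\<close>

definition subst :: "letter list \<Rightarrow> letter list \<Rightarrow> letter list \<Rightarrow> letter list" where
  "subst u v w = concat (map (case_letter u v) w)"

lemma morphism_subst: "morphism (subst u v)"
  by (simp add: morphism_def subst_def)

definition "\<psi>\<^sub>3 = subst [Zero] [Zero, One]"
definition "\<psi>\<^sub>4 = subst [Zero] [One, Zero]"
definition "\<psi>\<^sub>7 = subst [One, Zero] [One]"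
definition "\<psi>\<^sub>8 = subst [Zero, One] [One]"

inductive_set generated_monoid :: "('a \<Rightarrow> 'a) set \<Rightarrow> ('a \<Rightarrow> 'a) set" for S where
  id: "id \<in> generated_monoid S"
| gen: "f \<in> S \<Longrightarrow> f \<in> generated_monoid S"
| comp: "f \<in> generated_monoid S \<Longrightarrow> g \<in> generated_monoid S \<Longrightarrow> f \<circ> g \<in> generated_monoid S"

definition "\<M>\<^sub>3\<^sub>8 = generated_monoid {\<psi>\<^sub>3, \<psi>\<^sub>8}"
definition "\<M>\<^sub>4\<^sub>7 = generated_monoid {\<psi>\<^sub>4, \<psi>\<^sub>7}"

definition "\<M>\<^sub>3 = {\<psi>\<^sub>3 ^^ n | n. n \<ge> 0}"
definition "\<M>\<^sub>4 = {\<psi>\<^sub>4 ^^ n | n. n \<ge> 0}"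
definition "\<M>\<^sub>7 = {\<psi>\<^sub>7 ^^ n | n. n \<ge> 0}"
definition "\<M>\<^sub>8 = {\<psi>\<^sub>8 ^^ n | n. n \<ge> 0}"

end

theory Submission
  imports Defs
begin

text \<open>
  The word \<open>s\<^bsub>\<alpha>,0\<^esub>\<close> is governed by the direction \<open>(u, v)\<close> with \<open>\<alpha> = v / (u + v)\<close>:
  \<open>\<psi>\<^sub>3\<close> maps the word of \<open>(u, v)\<close> to that of \<open>(u + v, v)\<close>, and \<open>\<psi>\<^sub>8\<close> maps it to that of
  \<open>(u, u + v)\<close>. Hence a product of the two, with incidence matrix of determinant 1, fixes the word
  of its Perron eigenvector, which is irrational as soon as both generators occur.

  If some morphism other than the identity fixes \<open>c\<^sub>\<alpha>\<close>, then the letter frequencies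
  \<open>(1 - \<alpha>, \<alpha>)\<close> form an eigenvector of its nonnegative incidence matrix, so their ratio is the
  positive root of an integral quadratic form whose other root is negative. The subtractive
  Euclidean algorithm acts injectively on the finite set of such forms of a given nonsquare
  discriminant. It is therefore purely periodic, and a period spells out a product of \<open>\<psi>\<^sub>3\<close> and
  \<open>\<psi>\<^sub>8\<close> fixing \<open>s\<^bsub>\<alpha>,0\<^esub>\<close>. Exchanging the letters swaps \<open>\<alpha>\<close> with \<open>1 - \<alpha>\<close> and
  \<open>s\<close> with \<open>s'\<close>, which gives the statements on \<open>\<psi>\<^sub>4\<close> and \<open>\<psi>\<^sub>7\<close>.
\<close>

section \<open>Morphisms and images of infinite words\<close>

lemma morphism_Cons: "morphism f \<Longrightarrow> f (x # w) = f [x] @ f w"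
  by (metis append_Cons append_Nil morphism_def)

lemma morphism_id: "morphism id"
  by (simp add: morphism_def)

lemma morphism_comp: "morphism f \<Longrightarrow> morphism g \<Longrightarrow> morphism (f \<circ> g)"
  by (simp add: morphism_def)

lemma morphism_generators: "morphism \<psi>\<^sub>3" "morphism \<psi>\<^sub>4" "morphism \<psi>\<^sub>7" "morphism \<psi>\<^sub>8"
  by (simp_all add: \<psi>\<^sub>3_def \<psi>\<^sub>4_def \<psi>\<^sub>7_def \<psi>\<^sub>8_def morphism_subst)

lemma is_image_id: "is_image id x x"
  by (auto simp: is_image_def filterlim_ident)

lemma is_image_comp:
  assumes "is_image f x y" "is_image g y z"
  shows "is_image (g \<circ> f) x z"
proof -
  have eq: "f (prefix n x) = prefix (length (f (prefix n x))) y" for n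
    using assms(1) unfolding is_image_def by (metis subsequence_length diff_zero)
  have "\<exists>k. (g \<circ> f) (prefix n x) = prefix k z" for n
    using assms(2) eq unfolding is_image_def by (metis comp_apply)
  moreover have "filterlim (\<lambda>n. length (g (prefix (length (f (prefix n x))) y))) at_top sequentially"
    using assms unfolding is_image_def by (auto intro: filterlim_compose)
  ultimately show ?thesis
    unfolding is_image_def using eq by simp
qed

section \<open>Action of the generators on mechanical words\<close>

lemma letter_of_int_simps [simp]: "letter_of_int 0 = Zero" "letter_of_int 1 = One"
  by (simp_all add: letter_of_int_def)

lemma floor_eqI: "of_int k \<le> (x::real) \<Longrightarrow> x < of_int k + 1 \<Longrightarrow> \<lfloor>x\<rfloor> = k"
  by linarith

text \<open>Homogeneous coordinates for the slope: the generators act linearly on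
  \<open>(u, v)\<close>, and an eigenvector yields a fixed word because scaling changes
  nothing.\<close>

definition W :: "real \<Rightarrow> real \<Rightarrow> letter word" where
  "W u v = s (v / (u + v)) 0"

lemma W_scale: "l \<noteq> 0 \<Longrightarrow> W (l * u) (l * v) = W u v"
  by (simp add: W_def flip: distrib_left)

lemma W_slope: "W (1 - \<alpha>) \<alpha> = s \<alpha> 0"
  by (simp add: W_def)

text \<open>By telescoping, \<open>\<lfloor>n * \<beta>\<rfloor>\<close> counts the Ones among the
  first \<open>n\<close> letters. Each One gains a letter under \<open>\<psi>\<^sub>3\<close>, so
  this count gives the length of the image.\<close>

lemma psi3_prefix:
  assumes \<beta>: "0 < \<beta>" "\<beta> < 1"
  shows "\<psi>\<^sub>3 (prefix n (s \<beta> 0)) = prefix (n + nat \<lfloor>n * \<beta>\<rfloor>) (s (\<beta> / (1 + \<beta>)) 0)"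
proof (induction n)
  case 0
  then show ?case by (simp add: \<psi>\<^sub>3_def subst_def)
next
  case (Suc n)
  define \<gamma> where "\<gamma> = \<beta> / (1 + \<beta>)"
  define k where "k = nat \<lfloor>n * \<beta>\<rfloor>"
  have k: "\<lfloor>n * \<beta>\<rfloor> = int k"
    using \<beta> by (simp add: k_def)
  \<comment> \<open>At a block boundary \<open>i + j\<close> target letters have been read,
    \<open>j\<close> of them One, since \<open>\<psi>\<^sub>3\<close> preserves the number of
    Ones.\<close>
  have floor: "\<lfloor>real (i + j) * \<gamma>\<rfloor> = int j" if "\<lfloor>i * \<beta>\<rfloor> = int j" for i j :: nat
  proof (rule floor_eqI)
    have *: "real j \<le> i * \<beta>" "i * \<beta> < j + 1"
      using that by linarith+
    show "of_int (int j) \<le> real (i + j) * \<gamma>"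
      using * \<beta> by (simp add: \<gamma>_def field_simps)
    show "real (i + j) * \<gamma> < of_int (int j) + 1"
      using * \<beta> by (simp add: \<gamma>_def field_simps)
  qed
  \<comment> \<open>Both blocks start with Zero, so the floor stays put one position later.\<close>
  have next_zero: "\<lfloor>real (n + k + 1) * \<gamma>\<rfloor> = int k"
  proof (rule floor_eqI)
    have *: "real k \<le> n * \<beta>" "n * \<beta> < k + 1"
      using k by linarith+
    show "of_int (int k) \<le> real (n + k + 1) * \<gamma>"
      using * \<beta> by (simp add: \<gamma>_def field_simps)
    show "real (n + k + 1) * \<gamma> < of_int (int k) + 1"
      using * \<beta> by (simp add: \<gamma>_def field_simps)
  qed
  have zero: "s \<gamma> 0 (n + k) = Zero"
    using floor[OF k] next_zero by (simp add: s_def)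
  from floor_diff[OF \<beta>, of n 0] consider
    "\<lfloor>real (Suc n) * \<beta>\<rfloor> = int k" | "\<lfloor>real (Suc n) * \<beta>\<rfloor> = int (Suc k)"
    using k by fastforce
  then show ?case
  proof cases
    case 1
    have "s \<beta> 0 n = Zero"
      using 1 k by (simp add: s_def)
    moreover have "nat \<lfloor>real (Suc n) * \<beta>\<rfloor> = k"
      using 1 by linarith
    ultimately show ?thesis
      using Suc zero morphism_generators(1)
      by (simp add: morphism_def k_def[symmetric] \<gamma>_def[symmetric] del: of_nat_Suc)
        (simp add: \<psi>\<^sub>3_def subst_def)
  next
    case 2
    have "s \<beta> 0 n = One"
      using 2 k by (simp add: s_def)
    moreover have "nat \<lfloor>real (Suc n) * \<beta>\<rfloor> = Suc k"
      using 2 by linarith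
    moreover have "s \<gamma> 0 (Suc (n + k)) = One"
      using next_zero floor[OF 2] by (simp add: s_def add_ac)
    ultimately show ?thesis
      using Suc zero morphism_generators(1)
      by (simp add: morphism_def k_def[symmetric] \<gamma>_def[symmetric] del: of_nat_Suc)
        (simp add: \<psi>\<^sub>3_def subst_def)
  qed
qed

text \<open>Each block of \<open>\<psi>\<^sub>8\<close> contains exactly one One, and only Zeros are
  lengthened: \<open>n\<close> letters with \<open>k\<close> Ones give \<open>n\<close> Ones among
  \<open>2 * n - k\<close> letters.\<close>

lemma psi8_prefix:
  assumes \<beta>: "0 < \<beta>" "\<beta> < 1"
  shows "\<psi>\<^sub>8 (prefix n (s \<beta> 0)) = prefix (2 * n - nat \<lfloor>n * \<beta>\<rfloor>) (s (1 / (2 - \<beta>)) 0)"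
proof (induction n)
  case 0
  then show ?case by (simp add: \<psi>\<^sub>8_def subst_def)
next
  case (Suc n)
  define \<gamma> where "\<gamma> = 1 / (2 - \<beta>)"
  define k where "k = nat \<lfloor>n * \<beta>\<rfloor>"
  have k: "\<lfloor>n * \<beta>\<rfloor> = int k"
    using \<beta> by (simp add: k_def)
  \<comment> \<open>This keeps the natural subtraction \<open>2 * i - j\<close> from
    truncating.\<close>
  have le: "j \<le> i" if "\<lfloor>i * \<beta>\<rfloor> = int j" for i j :: nat
  proof -
    have "real j \<le> i * \<beta>" using that by linarith
    also have "\<dots> \<le> real i" using \<beta> by (intro mult_right_le_one_le) auto
    finally show ?thesis by simp
  qed
  have floor: "\<lfloor>real (2 * i - j) * \<gamma>\<rfloor> = int i" if "\<lfloor>i * \<beta>\<rfloor> = int j" for i j :: nat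
  proof (rule floor_eqI)
    have *: "real j \<le> i * \<beta>" "i * \<beta> < j + 1" "real (2 * i - j) = 2 * real i - real j"
      using that le[OF that] by linarith+
    show "of_int (int i) \<le> real (2 * i - j) * \<gamma>"
      using *(1,2) \<beta> unfolding *(3) by (simp add: \<gamma>_def field_simps)
    show "real (2 * i - j) * \<gamma> < of_int (int i) + 1"
      using *(1,2) \<beta> unfolding *(3) by (simp add: \<gamma>_def field_simps)
  qed
  have kn: "k \<le> n" using le[OF k] .
  define m where "m = 2 * n - k"
  have m: "real m = 2 * real n - real k" "2 * Suc n - k = Suc (Suc m)" "2 * Suc n - Suc k = Suc m"
    using kn by (auto simp: m_def)
  have floor_m: "\<lfloor>real m * \<gamma>\<rfloor> = int n"
    using floor[OF k] by (simp add: m_def)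
  from floor_diff[OF \<beta>, of n 0] consider
    "\<lfloor>real (Suc n) * \<beta>\<rfloor> = int k" | "\<lfloor>real (Suc n) * \<beta>\<rfloor> = int (Suc k)"
    using k by fastforce
  then show ?case
  proof cases
    case 1
    \<comment> \<open>The One of the block comes second. The bound
      \<open>(n + 1) * \<beta> < k + 1\<close>, valid as the source letter is Zero, holds the floor
      back.\<close>
    have "\<lfloor>real (m + 1) * \<gamma>\<rfloor> = int n"
    proof (rule floor_eqI)
      have *: "real k \<le> n * \<beta>" "(n + 1) * \<beta> < k + 1" "real (m + 1) = 2 * real n - real k + 1"
        using k m(1) real_of_int_floor_add_one_gt[of "real (Suc n) * \<beta>", unfolded 1]
        by (linarith, simp_all add: add.commute)
      show "of_int (int n) \<le> real (m + 1) * \<gamma>"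
        using *(1,2) \<beta> unfolding *(3) by (simp add: \<gamma>_def field_simps)
      show "real (m + 1) * \<gamma> < of_int (int n) + 1"
        using *(1,2) \<beta> unfolding *(3) by (simp add: \<gamma>_def field_simps)
    qed
    then have "s \<gamma> 0 m = Zero" "s \<gamma> 0 (Suc m) = One"
      using floor_m floor[OF 1, unfolded m] by (simp_all add: s_def add_ac)
    moreover have "s \<beta> 0 n = Zero"
      using 1 k by (simp add: s_def)
    moreover have "nat \<lfloor>real (Suc n) * \<beta>\<rfloor> = k"
      using 1 by linarith
    ultimately show ?thesis
      using Suc morphism_generators(4)
      by (simp add: morphism_def k_def[symmetric] \<gamma>_def[symmetric] m(2)[simplified] m_def[symmetric] del: of_nat_Suc)
        (simp add: \<psi>\<^sub>8_def subst_def)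
  next
    case 2
    have "s \<gamma> 0 m = One"
      using floor_m floor[OF 2, unfolded m] by (simp_all add: s_def add_ac)
    moreover have "s \<beta> 0 n = One"
      using 2 k by (simp add: s_def)
    moreover have "nat \<lfloor>real (Suc n) * \<beta>\<rfloor> = Suc k"
      using 2 by linarith
    ultimately show ?thesis
      using Suc morphism_generators(4)
      by (simp add: morphism_def k_def[symmetric] \<gamma>_def[symmetric] m(3)[simplified] m_def[symmetric] del: of_nat_Suc)
        (simp add: \<psi>\<^sub>8_def subst_def)
  qed
qed

lemma is_imageI_length_ge:
  assumes "\<And>n. \<exists>m. f (prefix n x) = prefix m y" "\<And>w. length w \<le> length (f w)"
  shows "is_image f x y"
proof -
  have "n \<le> length (f (prefix n x))" for n
    using assms(2)[of "prefix n x"] by simp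
  then show ?thesis
    unfolding is_image_def using assms(1) by (auto intro!: filterlim_at_top_mono[OF filterlim_ident])
qed

lemma length_psi_ge: "length w \<le> length (\<psi>\<^sub>3 w)" "length w \<le> length (\<psi>\<^sub>8 w)"
  by (induction w) (auto simp: \<psi>\<^sub>3_def \<psi>\<^sub>8_def subst_def split: letter.split)

lemma is_image_psi3:
  assumes "0 < u" "0 < v"
  shows "is_image \<psi>\<^sub>3 (W u v) (W (u + v) v)"
proof (rule is_imageI_length_ge[OF _ length_psi_ge(1)])
  have "1 + v / (u + v) = (u + v + v) / (u + v)"
    using assms by (simp add: field_simps)
  then have "(v / (u + v)) / (1 + v / (u + v)) = v / (u + v + v)"
    using assms by simp
  then show "\<exists>m. \<psi>\<^sub>3 (prefix n (W u v)) = prefix m (W (u + v) v)" for n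
    using psi3_prefix[of "v / (u + v)" n] assms unfolding W_def by auto
qed

lemma is_image_psi8:
  assumes "0 < u" "0 < v"
  shows "is_image \<psi>\<^sub>8 (W u v) (W u (u + v))"
proof (rule is_imageI_length_ge[OF _ length_psi_ge(2)])
  have "1 / (2 - v / (u + v)) = (u + v) / (u + (u + v))"
    using assms by (simp add: field_simps)
  then show "\<exists>m. \<psi>\<^sub>8 (prefix n (W u v)) = prefix m (W u (u + v))" for n
    using psi8_prefix[of "v / (u + v)" n] assms unfolding W_def by auto
qed

section \<open>Incidence matrices\<close>

text \<open>Rows are indexed by the counted letter. Quantifying over all words instead of the two
  letters makes composition a matrix product by mere substitution.\<close>

definition incidence :: "(letter list \<Rightarrow> letter list) \<Rightarrow> nat \<Rightarrow> nat \<Rightarrow> nat \<Rightarrow> nat \<Rightarrow> bool" where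
  "incidence f a b d e \<longleftrightarrow> (\<forall>w.
     count_list (f w) Zero = a * count_list w Zero + b * count_list w One \<and>
     count_list (f w) One = d * count_list w Zero + e * count_list w One)"

lemma incidence_morphism:
  assumes "morphism f"
  shows "incidence f (count_list (f [Zero]) Zero) (count_list (f [One]) Zero)
    (count_list (f [Zero]) One) (count_list (f [One]) One)"
  unfolding incidence_def
proof
  fix w
  show "count_list (f w) Zero = count_list (f [Zero]) Zero * count_list w Zero
      + count_list (f [One]) Zero * count_list w One \<and>
    count_list (f w) One = count_list (f [Zero]) One * count_list w Zero
      + count_list (f [One]) One * count_list w One"
  proof (induction w)
    case Nil
    then show ?case using assms by (simp add: morphism_def)
  next
    case (Cons x w)
    then show ?case
      by (cases x) (simp_all add: morphism_Cons[OF assms, of _ w])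
  qed
qed

lemma incidence_comp:
  assumes "incidence f a b d e" "incidence g a' b' d' e'"
  shows "incidence (f \<circ> g) (a * a' + b * d') (a * b' + b * e') (d * a' + e * d') (d * b' + e * e')"
  using assms by (simp add: incidence_def algebra_simps)

lemma length_count: "length w = count_list w Zero + count_list w One" for w :: "letter list"
proof (induction w)
  case (Cons x w)
  then show ?case by (cases x) auto
qed simp

section \<open>Matrices and actions of the elements of \<open>\<M>\<^sub>3\<^sub>8\<close>\<close>

lemma M3_comp: "f \<in> \<M>\<^sub>3 \<Longrightarrow> g \<in> \<M>\<^sub>3 \<Longrightarrow> f \<circ> g \<in> \<M>\<^sub>3"
  by (auto simp: \<M>\<^sub>3_def funpow_add[symmetric])

lemma M8_comp: "f \<in> \<M>\<^sub>8 \<Longrightarrow> g \<in> \<M>\<^sub>8 \<Longrightarrow> f \<circ> g \<in> \<M>\<^sub>8"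
  by (auto simp: \<M>\<^sub>8_def funpow_add[symmetric])

lemma M3_M8_elements: "id \<in> \<M>\<^sub>3" "id \<in> \<M>\<^sub>8" "\<psi>\<^sub>3 \<in> \<M>\<^sub>3" "\<psi>\<^sub>8 \<in> \<M>\<^sub>8"
  unfolding \<M>\<^sub>3_def \<M>\<^sub>8_def
  by (auto intro: exI[of _ 0] exI[of _ 1])

text \<open>Determinant 1 makes the diagonal entries positive. Hence an off-diagonal entry of a
  product vanishes only if it vanishes in both factors, and directions stay in the open
  quadrant.\<close>

lemma M38_incidence:
  assumes "\<psi> \<in> \<M>\<^sub>3\<^sub>8"
  shows "\<exists>a b d e. incidence \<psi> a b d e \<and> a * e = b * d + 1 \<and>
    (b = 0 \<longrightarrow> \<psi> \<in> \<M>\<^sub>8) \<and> (d = 0 \<longrightarrow> \<psi> \<in> \<M>\<^sub>3) \<and>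
    (\<forall>u>0. \<forall>v>0. is_image \<psi> (W u v) (W (a * u + b * v) (d * u + e * v)))"
  using assms unfolding \<M>\<^sub>3\<^sub>8_def
proof (induction rule: generated_monoid.induct)
  case id
  have "incidence id 1 0 0 1" by (simp add: incidence_def)
  then show ?case
    using M3_M8_elements(1,2) is_image_id
    by (intro exI[of _ "1::nat"] exI[of _ "0::nat"]) (simp del: id_apply)
next
  case (gen f)
  then consider "f = \<psi>\<^sub>3" | "f = \<psi>\<^sub>8" by blast
  then show ?case
  proof cases
    case 1
    have "incidence \<psi>\<^sub>3 1 1 0 1"
      using incidence_morphism[OF morphism_generators(1)] by (simp add: \<psi>\<^sub>3_def subst_def)
    then show ?thesis
      unfolding 1
      by (intro exI[of _ "1::nat"] exI[of _ "0::nat"]) (simp add: M3_M8_elements is_image_psi3)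
  next
    case 2
    have "incidence \<psi>\<^sub>8 1 0 1 1"
      using incidence_morphism[OF morphism_generators(4)] by (simp add: \<psi>\<^sub>8_def subst_def)
    then show ?thesis
      unfolding 2
      by (intro exI[of _ "1::nat"] exI[of _ "0::nat"]) (simp add: M3_M8_elements is_image_psi8)
  qed
next
  case (comp f g)
  obtain a b d e where f: "incidence f a b d e" "a * e = b * d + 1"
    "b = 0 \<longrightarrow> f \<in> \<M>\<^sub>8" "d = 0 \<longrightarrow> f \<in> \<M>\<^sub>3"
    "\<And>u v. u > 0 \<Longrightarrow> v > 0 \<Longrightarrow> is_image f (W u v) (W (a * u + b * v) (d * u + e * v))"
    using comp.IH(1) by blast
  obtain a' b' d' e' where g: "incidence g a' b' d' e'" "a' * e' = b' * d' + 1"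
    "b' = 0 \<longrightarrow> g \<in> \<M>\<^sub>8" "d' = 0 \<longrightarrow> g \<in> \<M>\<^sub>3"
    "\<And>u v. u > 0 \<Longrightarrow> v > 0 \<Longrightarrow> is_image g (W u v) (W (a' * u + b' * v) (d' * u + e' * v))"
    using comp.IH(2) by blast
  have pos: "a > 0" "e > 0" "a' > 0" "e' > 0"
    using f(2) g(2) by (auto intro: gr0I)
  \<comment> \<open>Multiplicativity of the determinant, computed in the integers because natural
    subtraction truncates.\<close>
  have "int (a * a' + b * d') * int (d * b' + e * e') - int (a * b' + b * e') * int (d * a' + e * d')
    = (int (a * e) - int (b * d)) * (int (a' * e') - int (b' * d'))"
    by (simp add: algebra_simps)
  also have "\<dots> = 1"
    using f(2) g(2) by simp
  finally have "int ((a * a' + b * d') * (d * b' + e * e'))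
    = int ((a * b' + b * e') * (d * a' + e * d') + 1)"
    unfolding of_nat_mult of_nat_add of_nat_1 by linarith
  then have det: "(a * a' + b * d') * (d * b' + e * e') = (a * b' + b * e') * (d * a' + e * d') + 1"
    by (simp only: of_nat_eq_iff)
  have image: "is_image (f \<circ> g) (W u v)
     (W ((a * a' + b * d' :: nat) * u + (a * b' + b * e' :: nat) * v)
        ((d * a' + e * d' :: nat) * u + (d * b' + e * e' :: nat) * v))"
    if "u > 0" "v > 0" for u v :: real
  proof -
    have "0 < a' * u + b' * v" "0 < d' * u + e' * v"
      using pos that by (simp_all add: add_pos_nonneg add_nonneg_pos)
    from is_image_comp[OF g(5)[OF that] f(5)[OF this]] show ?thesis
      by (simp add: algebra_simps)
  qed
  have "a * b' + b * e' = 0 \<longrightarrow> f \<circ> g \<in> \<M>\<^sub>8" "d * a' + e * d' = 0 \<longrightarrow> f \<circ> g \<in> \<M>\<^sub>3"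
    using pos f(3,4) g(3,4) by (auto intro: M3_comp M8_comp)
  with incidence_comp[OF f(1) g(1)] det image show ?case
    by (intro exI conjI allI impI) (assumption | erule (1) mp | (rule image, assumption+))+
qed

text \<open>
  Conjugation by the image of the leading letter 0 turns an action on \<open>0 c\<^sub>\<alpha>\<close> into
  one on \<open>c\<^sub>\<alpha>\<close>.
\<close>

lemma M38_conjugate:
  assumes "\<psi> \<in> \<M>\<^sub>3\<^sub>8"
  shows "\<exists>f p. morphism \<psi> \<and> morphism f \<and> \<psi> [Zero] = Zero # p \<and> (\<forall>w. f w @ p = p @ \<psi> w)"
  using assms unfolding \<M>\<^sub>3\<^sub>8_def
proof (induction rule: generated_monoid.induct)
  case id
  then show ?case using morphism_id by (metis append_Nil append_Nil2 id_apply)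
next
  case (gen f)
  then consider "f = \<psi>\<^sub>3" | "f = \<psi>\<^sub>8" by blast
  then show ?case
  proof cases
    case 1
    then show ?thesis
      using morphism_generators(1)
      by (intro exI[of _ "\<psi>\<^sub>3"] exI[of _ "[]"]) (simp, simp add: \<psi>\<^sub>3_def subst_def)
  next
    case 2
    \<comment> \<open>The conjugate of \<open>\<psi>\<^sub>8\<close> by the tail of its image of
      Zero is \<open>\<psi>\<^sub>7\<close>.\<close>
    have "\<psi>\<^sub>7 w @ [One] = [One] @ \<psi>\<^sub>8 w" for w
      by (induction w) (auto simp: \<psi>\<^sub>7_def \<psi>\<^sub>8_def subst_def split: letter.split)
    moreover have "\<psi>\<^sub>8 [Zero] = [Zero, One]" by (simp add: \<psi>\<^sub>8_def subst_def)
    ultimately show ?thesis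
      using morphism_generators 2 by blast
  qed
next
  case (comp f g)
  obtain f' p where f: "morphism f" "morphism f'" "f [Zero] = Zero # p" "\<And>w. f' w @ p = p @ f w"
    using comp.IH(1) by blast
  obtain g' q where g: "morphism g" "morphism g'" "g [Zero] = Zero # q" "\<And>w. g' w @ q = q @ g w"
    using comp.IH(2) by blast
  have "(f \<circ> g) [Zero] = Zero # p @ f q"
    using f g morphism_Cons[OF f(1), of Zero q] by simp
  moreover have "(f' \<circ> g') w @ p @ f q = (p @ f q) @ (f \<circ> g) w" for w
  proof -
    have "(f' \<circ> g') w @ p @ f q = f' (g' w @ q) @ p"
      using f by (simp add: morphism_def f(4)[symmetric])
    also have "\<dots> = p @ f (q @ g w)"
      by (simp add: g(4) f(4))
    finally show ?thesis
      using f(1) by (simp add: morphism_def)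
  qed
  ultimately show ?case
    using morphism_comp f g by blast
qed

lemma prefix_s_c:
  assumes "0 < \<alpha>" "\<alpha> < 1"
  shows "prefix (Suc n) (s \<alpha> 0) = Zero # prefix n (c \<alpha>)"
proof -
  have "\<lfloor>\<alpha>\<rfloor> = 0"
    using assms by linarith
  then have "s \<alpha> 0 0 = Zero"
    by (simp add: s_def)
  moreover have "s \<alpha> 0 (Suc i) = c \<alpha> i" for i
    by (simp add: s_def c_def algebra_simps)
  ultimately show ?thesis
    by (induction n) auto
qed

text \<open>Being a Sturm number concerns \<open>c \<alpha>\<close>, the word without its leading
  Zero. The conjugate \<open>f\<close> fixes it, and \<open>b > 0\<close>, which follows from
  \<open>\<psi> \<notin> \<M>\<^sub>8\<close>, separates \<open>f\<close> from the identity.\<close>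

lemma fixed_imp_Sturm_number:
  assumes \<psi>: "\<psi> \<in> \<M>\<^sub>3\<^sub>8" "\<psi> \<notin> \<M>\<^sub>8" and fixed: "fixes_word \<psi> (s \<alpha> 0)"
    and \<alpha>: "\<alpha> \<notin> \<rat>" "0 < \<alpha>" "\<alpha> < 1"
  shows "Sturm_number \<alpha>"
proof -
  obtain f p where f: "morphism \<psi>" "morphism f" "\<psi> [Zero] = Zero # p" "\<And>w. f w @ p = p @ \<psi> w"
    using M38_conjugate[OF \<psi>(1)] by blast
  obtain a b d e where inc: "incidence \<psi> a b d e" "a * e = b * d + 1" "b = 0 \<longrightarrow> \<psi> \<in> \<M>\<^sub>8"
    using M38_incidence[OF \<psi>(1)] by blast
  have b: "b > 0" using inc \<psi> by auto
  \<comment> \<open>Cancelling the letters of \<open>p\<close> in the conjugacy relation shows that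
    \<open>f\<close> and \<open>\<psi>\<close> have the same incidence matrix.\<close>
  have count: "count_list (f w) l = count_list (\<psi> w) l" for w l
    using arg_cong[OF f(4), of "\<lambda>x. count_list x l" w] by simp
  have "a > 0" "e > 0" using inc(2) by (auto intro: gr0I)
  then have len: "length w \<le> length (f w)" for w
    using inc(1) by (simp add: length_count count incidence_def add_mono trans_le_add1 trans_le_add2)
  have "\<exists>m. f (prefix n (c \<alpha>)) = prefix m (c \<alpha>)" for n
  proof -
    obtain m where m: "\<psi> (prefix (Suc n) (s \<alpha> 0)) = prefix m (s \<alpha> 0)"
      using fixed unfolding fixes_word_def is_image_def by blast
    have *: "\<psi> (prefix (Suc n) (s \<alpha> 0)) = Zero # f (prefix n (c \<alpha>)) @ p"
      unfolding prefix_s_c[OF \<alpha>(2,3)] using morphism_Cons[OF f(1), of Zero "prefix n (c \<alpha>)"] f(3,4) by simp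
    have "m \<noteq> 0"
      using m unfolding * by (intro notI) simp
    then obtain k where "m = Suc k" using not0_implies_Suc by blast
    then have "Zero # f (prefix n (c \<alpha>)) @ p = prefix (Suc k) (s \<alpha> 0)"
      using m * by metis
    then have eq: "f (prefix n (c \<alpha>)) @ p = prefix k (c \<alpha>)"
      unfolding prefix_s_c[OF \<alpha>(2,3)] by simp
    \<comment> \<open>The trailing \<open>p\<close> is cut off: an initial segment of a prefix is
      again a prefix.\<close>
    define l where "l = length (f (prefix n (c \<alpha>)))"
    have "l \<le> k"
      using arg_cong[OF eq, of length] by (simp add: l_def)
    then have "take l (prefix k (c \<alpha>)) = prefix l (c \<alpha>)"
      by simp
    moreover have "take l (f (prefix n (c \<alpha>)) @ p) = f (prefix n (c \<alpha>))"
      by (simp add: l_def)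
    ultimately have "f (prefix n (c \<alpha>)) = prefix l (c \<alpha>)"
      unfolding eq by metis
    then show ?thesis by blast
  qed
  then have "fixes_word f (c \<alpha>)"
    unfolding fixes_word_def using is_imageI_length_ge len by blast
  moreover have "f \<noteq> id"
    using inc(1) count[of "[One]" Zero] b by (auto simp: incidence_def)
  ultimately show ?thesis
    using \<alpha> f(2) unfolding Sturm_number_def by blast
qed

section \<open>Irrational eigenvectors and the words they give\<close>

lemma sqrt_Rats_imp_square:
  fixes D :: int
  assumes "sqrt (real_of_int D) \<in> \<rat>" "D \<ge> 0"
  shows "\<exists>k\<ge>0. D = k\<^sup>2"
proof -
  obtain m n :: nat where mn: "n \<noteq> 0" "\<bar>sqrt (real_of_int D)\<bar> = m / n" "coprime m n"
    using assms(1) by (rule Rats_abs_nat_div_natE)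
  have "real m = sqrt (real_of_int D) * n"
    using mn assms(2) by (simp add: field_simps)
  then have "(real m)\<^sup>2 = real_of_int D * (real n)\<^sup>2"
    using assms(2) by (simp add: power_mult_distrib)
  then have "real_of_int ((int m)\<^sup>2) = real_of_int (D * (int n)\<^sup>2)"
    by simp
  then have eq: "(int m)\<^sup>2 = D * (int n)\<^sup>2"
    by (simp only: of_int_eq_iff)
  then have "(int n)\<^sup>2 dvd (int m)\<^sup>2" by simp
  then have "n dvd m" by (simp add: pow_divides_pow_iff)
  then have "n = 1" using mn(3) by (metis coprime_absorb_right is_unit_gcd nat_dvd_1_iff_1)
  with eq show ?thesis by (intro exI[of _ "int m"]) simp
qed

text \<open>Excluding \<open>\<M>\<^sub>3\<close> and \<open>\<M>\<^sub>8\<close> makes both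
  off-diagonal entries positive. The dominant eigenvector is then positive with irrational slope,
  and scale invariance makes its word fixed.\<close>

lemma M38_fixes:
  assumes \<psi>: "\<psi> \<in> \<M>\<^sub>3\<^sub>8 - (\<M>\<^sub>3 \<union> \<M>\<^sub>8)"
  shows "\<exists>\<alpha>. Sturm_number \<alpha> \<and> fixes_word \<psi> (s \<alpha> 0)"
proof -
  obtain a b d e where m: "incidence \<psi> a b d e" "a * e = b * d + 1"
    "b = 0 \<longrightarrow> \<psi> \<in> \<M>\<^sub>8" "d = 0 \<longrightarrow> \<psi> \<in> \<M>\<^sub>3"
    "\<And>u v. u > 0 \<Longrightarrow> v > 0 \<Longrightarrow> is_image \<psi> (W u v) (W (a * u + b * v) (d * u + e * v))"
    using M38_incidence[of \<psi>] \<psi> by blast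
  have b: "b > 0" "d > 0" using m \<psi> by auto
  \<comment> \<open>The characteristic polynomial is \<open>x^2 - (a + e) * x + 1\<close>;
    \<open>D\<close> is its discriminant and \<open>l\<close> its larger root.\<close>
  define D where "D = (real a + real e)\<^sup>2 - 4"
  define l where "l = (real a + real e + sqrt D) / 2"
  have det: "real a * real e = real b * real d + 1"
    using m(2) by (metis of_nat_1 of_nat_add of_nat_mult)
  have D: "D = (real a - real e)\<^sup>2 + 4 * real b * real d"
    unfolding D_def using det by (simp add: power2_eq_square algebra_simps)
  have sqrtD: "sqrt D > \<bar>real a - real e\<bar>"
    unfolding D using b by (intro real_less_rsqrt) simp
  have D0: "D > 0"
    unfolding D using b by (simp add: add_nonneg_pos)
  then have sq: "(sqrt D)\<^sup>2 = D" by simp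
  define t where "t = int a + int e"
  have t: "t \<ge> 3"
  proof -
    have "a * e > 1" using m(2) b by simp
    then have "a > 0" "e > 0" "a > 1 \<or> e > 1" by (auto intro: gr0I simp: not_less le_Suc_eq)
    then show ?thesis by (auto simp: t_def)
  qed
  text \<open>\<open>D = t\<^sup>2 - 4\<close> lies strictly between the squares of \<open>t - 1\<close> and \<open>t\<close>.\<close>
  have irr: "sqrt D \<notin> \<rat>"
  proof
    assume "sqrt D \<in> \<rat>"
    moreover have Dt: "D = real_of_int (t\<^sup>2 - 4)" by (simp add: D_def t_def)
    moreover from this have "t\<^sup>2 - 4 \<ge> 0"
      using D0 by linarith
    ultimately obtain k where k: "t\<^sup>2 - 4 = k\<^sup>2" "k \<ge> 0"
      using sqrt_Rats_imp_square[of "t\<^sup>2 - 4"] by metis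
    have "(t - 1)\<^sup>2 < k\<^sup>2" "k\<^sup>2 < t\<^sup>2"
      using k t by (simp_all add: power2_diff)
    then have "t - 1 < k" "k < t"
      using k(2) t power2_less_imp_less[of "t - 1" k] power2_less_imp_less[of k t] by auto
    then show False by simp
  qed
  have l: "l > real a" using sqrtD by (simp add: l_def)
  have char: "l * l = (real a + real e) * l - 1"
    using sq by (simp add: l_def D_def power2_eq_square field_simps)
  \<comment> \<open>Solves the first row \<open>(l - a) * u = b * v\<close> of the eigenvector
    equation.\<close>
  define u v where "u = real b" and "v = l - real a"
  have uv: "u > 0" "v > 0" using b l by (simp_all add: u_def v_def)
  have eig: "a * u + b * v = l * u" "d * u + e * v = l * v"
    using char det by (simp_all add: u_def v_def algebra_simps)
  define \<alpha> where "\<alpha> = v / (u + v)"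
  have \<alpha>: "0 < \<alpha>" "\<alpha> < 1" using uv by (simp_all add: \<alpha>_def)
  have "\<alpha> \<notin> \<rat>"
  proof
    assume "\<alpha> \<in> \<rat>"
    moreover have "1 - \<alpha> = u / (u + v)"
      using uv by (simp add: \<alpha>_def field_simps)
    then have "\<alpha> / (1 - \<alpha>) = v / u"
      using uv by (simp add: \<alpha>_def)
    \<comment> \<open>A rational slope would make \<open>sqrt D\<close> rational.\<close>
    then have "sqrt D = 2 * (u * (\<alpha> / (1 - \<alpha>)) + real a) - real a - real e"
      using uv by (simp add: v_def l_def add_divide_distrib)
    moreover have "u \<in> \<rat>" by (simp add: u_def)
    ultimately show False
      using irr by simp
  qed
  moreover have "fixes_word \<psi> (s \<alpha> 0)"
    using m(5)[OF uv] W_scale[of l u v] l unfolding eig fixes_word_def W_def \<alpha>_def by simp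
  ultimately show ?thesis
    using fixed_imp_Sturm_number[of \<psi> \<alpha>] \<psi> \<alpha> by blast
qed

section \<open>Letter frequencies of fixed characteristic words\<close>

text \<open>The differences telescope; the intercept \<open>\<alpha>\<close> of \<open>c\<close>
  shifts the index to \<open>Suc n\<close>.\<close>

lemma count_c:
  assumes "0 < \<alpha>" "\<alpha> < 1"
  shows "int (count_list (prefix n (c \<alpha>)) One) = \<lfloor>real (Suc n) * \<alpha>\<rfloor>"
proof (induction n)
  case 0
  then show ?case using assms by (simp add: floor_eq_iff)
next
  case (Suc n)
  have "real (n + 1) * \<alpha> + \<alpha> = real (Suc (Suc n)) * \<alpha>" "real n * \<alpha> + \<alpha> = real (Suc n) * \<alpha>"
    by (simp_all add: algebra_simps)
  then have diff: "c \<alpha> n = letter_of_int (\<lfloor>real (Suc (Suc n)) * \<alpha>\<rfloor> - \<lfloor>real (Suc n) * \<alpha>\<rfloor>)"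
    "\<lfloor>real (Suc (Suc n)) * \<alpha>\<rfloor> - \<lfloor>real (Suc n) * \<alpha>\<rfloor> \<in> {0, 1}"
    using floor_diff[OF assms, of n \<alpha>] by (simp_all only: c_def s_def)
  from diff(2) show ?case
    using diff(1) Suc by (auto simp del: of_nat_Suc)
qed

lemma count_c_bound:
  assumes "0 < \<alpha>" "\<alpha> < 1"
  shows "\<bar>real (count_list (prefix n (c \<alpha>)) One) - n * \<alpha>\<bar> \<le> 1"
proof -
  have "real (count_list (prefix n (c \<alpha>)) One) = of_int \<lfloor>real (Suc n) * \<alpha>\<rfloor>"
    by (simp only: count_c[OF assms, symmetric] of_int_of_nat_eq)
  moreover have "real (Suc n) * \<alpha> = n * \<alpha> + \<alpha>"
    by (simp add: algebra_simps)
  ultimately show ?thesis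
    using assms by linarith
qed

lemma bounded_multiples_imp_zero:
  fixes K B :: real
  assumes "\<And>n::nat. \<bar>n * K\<bar> \<le> B"
  shows "K = 0"
proof (rule ccontr)
  assume "K \<noteq> 0"
  then obtain n :: nat where "B < n * \<bar>K\<bar>"
    using reals_Archimedean3[of "\<bar>K\<bar>"] by auto
  with assms[of n] show False by (simp add: abs_mult)
qed

text \<open>The eigenvector equation for the frequencies, with the eigenvalue eliminated. Prefixes
  of the word have bounded discrepancy, while the image of \<open>n\<close> letters has discrepancy
  \<open>n * K\<close> up to a constant, so \<open>K = 0\<close>.\<close>

lemma fixed_c_eigenvector:
  assumes \<alpha>: "0 < \<alpha>" "\<alpha> < 1"
    and fixed: "fixes_word f (c \<alpha>)" and inc: "incidence f a b d e"
  shows "(1 - \<alpha>) * (d * (1 - \<alpha>) + e * \<alpha>) = \<alpha> * (a * (1 - \<alpha>) + b * \<alpha>)"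
proof -
  \<comment> \<open>\<open>K\<close> is the mean excess of Ones over \<open>\<alpha>\<close> times
    the length that a source letter contributes to the image; \<open>K'\<close> is the change in
    that excess when a Zero becomes a One.\<close>
  define K where "K = (d * (1 - \<alpha>) + e * \<alpha>) - \<alpha> * ((a + d) * (1 - \<alpha>) + (b + e) * \<alpha>)"
  define K' where "K' = (real e - real d) - \<alpha> * (real b + real e - real a - real d)"
  have "\<bar>n * K\<bar> \<le> 1 + \<bar>K'\<bar>" for n :: nat
  proof -
    define w where "w = prefix n (c \<alpha>)"
    obtain m where m: "f w = prefix m (c \<alpha>)"
      using fixed unfolding fixes_word_def is_image_def w_def by blast
    define \<delta> where "\<delta> = real (count_list w One) - n * \<alpha>"
    have \<delta>: "\<bar>\<delta>\<bar> \<le> 1" using count_c_bound[OF \<alpha>] by (simp add: \<delta>_def w_def)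
    have one: "real (count_list w One) = n * \<alpha> + \<delta>" by (simp add: \<delta>_def)
    have "real n = real (length w)" by (simp add: w_def)
    then have zero: "real (count_list w Zero) = n - (n * \<alpha> + \<delta>)"
      unfolding length_count by (simp add: \<delta>_def)
    have "\<bar>real (count_list (f w) One) - m * \<alpha>\<bar> \<le> 1"
      unfolding m by (rule count_c_bound[OF \<alpha>])
    moreover have "m = count_list (f w) Zero + count_list (f w) One"
      unfolding length_count[symmetric] by (simp add: m)
    moreover have "real (count_list (f w) Zero) = a * (n - (n * \<alpha> + \<delta>)) + b * (n * \<alpha> + \<delta>)"
      "real (count_list (f w) One) = d * (n - (n * \<alpha> + \<delta>)) + e * (n * \<alpha> + \<delta>)"
      using inc by (simp_all add: incidence_def zero one)
    ultimately have "\<bar>n * K + \<delta> * K'\<bar> \<le> 1"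
      by (simp add: K_def K'_def algebra_simps)
    moreover have "\<bar>\<delta> * K'\<bar> \<le> \<bar>K'\<bar>"
      using \<delta> by (simp add: abs_mult mult_left_le_one_le)
    ultimately show ?thesis by linarith
  qed
  then have "K = 0" by (rule bounded_multiples_imp_zero)
  then show ?thesis by (simp add: K_def algebra_simps)
qed

lemma c_not_constant:
  assumes "0 < \<alpha>" "\<alpha> < 1"
  shows "\<exists>n. c \<alpha> n \<noteq> c \<alpha> 0"
proof (rule ccontr)
  assume "\<not> ?thesis"
  then have const: "c \<alpha> n = c \<alpha> 0" for n by blast
  show False
  proof (cases "c \<alpha> 0")
    case Zero
    then have "count_list (prefix n (c \<alpha>)) One = 0" for n
      using const by (induction n) auto
    then have "\<bar>n * \<alpha>\<bar> \<le> 1" for n :: nat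
      using count_c_bound[OF assms, of n] by simp
    then show False using assms bounded_multiples_imp_zero by blast
  next
    case One
    then have "count_list (prefix n (c \<alpha>)) One = n" for n
      using const by (induction n) auto
    then have "\<bar>n * (1 - \<alpha>)\<bar> \<le> 1" for n :: nat
      using count_c_bound[OF assms, of n] by (simp add: algebra_simps)
    then show False using assms bounded_multiples_imp_zero[of "1 - \<alpha>"] by auto
  qed
qed

text \<open>
  A scalar incidence matrix \<open>a I\<close> with \<open>a \<ge> 2\<close> would prolong the initial run of equal letters.
\<close>

lemma fixed_c_scalar_imp_id:
  assumes \<alpha>: "0 < \<alpha>" "\<alpha> < 1" and f: "morphism f" "incidence f a 0 0 a"
    and fixed: "fixes_word f (c \<alpha>)"
  shows "f = id"
proof -
  have count: "count_list (f w) l = a * count_list w l" for w l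
    using f(2) by (cases l) (simp_all add: incidence_def)
  have len: "length (f w) = a * length w" for w
    by (simp add: length_count count algebra_simps)
  \<comment> \<open>If all letters were erased, the image would not be infinite, as
    \<open>is_image\<close> demands.\<close>
  have a0: "a \<noteq> 0"
  proof
    assume "a = 0"
    then have "filterlim (\<lambda>n. 0::nat) at_top sequentially"
      using fixed len by (simp add: fixes_word_def is_image_def)
    then have "eventually (\<lambda>n::nat. 1 \<le> (0::nat)) sequentially"
      unfolding filterlim_at_top by blast
    then show False by simp
  qed
  have "a < 2"
  proof (rule ccontr)
    assume "\<not> a < 2"
    then have a: "a \<ge> 2" by simp
    \<comment> \<open>The image of the initial run of length \<open>k\<close> uses only the letter
      of that run, yet it would reach beyond position \<open>k\<close>.\<close>
    define k where "k = (LEAST k. c \<alpha> k \<noteq> c \<alpha> 0)"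
    have k: "c \<alpha> k \<noteq> c \<alpha> 0"
      unfolding k_def using c_not_constant[OF \<alpha>] by (rule LeastI_ex)
    have least: "c \<alpha> i = c \<alpha> 0" if "i < k" for i
      using that not_less_Least unfolding k_def by blast
    have "k > 0" using k by (auto intro: gr0I)
    then have ak: "k < a * k" using a by simp
    have "c \<alpha> k \<notin> set (prefix k (c \<alpha>))"
      unfolding set_subsequence using k least by (metis atLeastLessThan_iff imageE)
    then have "count_list (f (prefix k (c \<alpha>))) (c \<alpha> k) = 0"
      by (simp add: count)
    moreover obtain m where m: "f (prefix k (c \<alpha>)) = prefix m (c \<alpha>)"
      using fixed unfolding fixes_word_def is_image_def by blast
    moreover have "m = a * k"
      using arg_cong[OF m, of length] by (simp add: len)
    ultimately show False
      using ak by (simp add: count_list_0_iff)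
  qed
  then have [simp]: "a = 1" using a0 by simp
  have "f [x] = [x]" for x
    using len[of "[x]"] count[of "[x]" x] by (auto simp: length_Suc_conv split: if_splits)
  then have "f w = w" for w
  proof (induction w)
    case Nil
    then show ?case using f(1) by (simp add: morphism_def)
  next
    case (Cons x w)
    then show ?case using morphism_Cons[OF f(1), of x w] by simp
  qed
  then show ?thesis by auto
qed

text \<open>The eigenvector relation gives the coefficients \<open>- d\<close>,
  \<open>a - e\<close>, \<open>b\<close>. If \<open>b\<close> or \<open>d\<close> vanished,
  irrationality would force a scalar matrix and so \<open>f = id\<close>; hence the strict
  signs.\<close>

lemma Sturm_number_form:
  assumes "Sturm_number \<alpha>"
  shows "\<exists>(p::int) (r::int) (q::int). p < 0 \<and> 0 < q \<and>
    real_of_int p * (1 - \<alpha>)\<^sup>2 + real_of_int r * (1 - \<alpha>) * \<alpha> + real_of_int q * \<alpha>\<^sup>2 = 0"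
proof -
  obtain f where \<alpha>: "\<alpha> \<notin> \<rat>" "0 < \<alpha>" "\<alpha> < 1"
    and f: "morphism f" "f \<noteq> id" "fixes_word f (c \<alpha>)"
    using assms unfolding Sturm_number_def by blast
  obtain a b d e where inc: "incidence f a b d e"
    using incidence_morphism[OF f(1)] by blast
  note eig = fixed_c_eigenvector[OF \<alpha>(2,3) f(3) inc]
  have irr: "x = 0" if "x * \<alpha> = y" "x \<in> \<rat>" "y \<in> \<rat>" for x y
  proof (rule ccontr)
    assume "x \<noteq> 0"
    then have "\<alpha> = y / x" using that by (simp add: field_simps)
    then show False using \<alpha> that by simp
  qed
  have "b \<noteq> 0 \<and> d \<noteq> 0"
  proof (rule ccontr)
    assume "\<not> (b \<noteq> 0 \<and> d \<noteq> 0)"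
    then have "b = 0 \<and> d = 0 \<and> a = e"
    proof (cases "d = 0")
      case True
      then have "\<alpha> * ((b + e - real a) * \<alpha>) = \<alpha> * (e - real a)"
        using eig by (simp add: algebra_simps)
      then have *: "(b + e - real a) * \<alpha> = e - real a"
        using \<alpha> by simp
      then have "b + e - real a = 0" by (rule irr) auto
      with * True show ?thesis by auto
    next
      case False
      with \<open>\<not> (b \<noteq> 0 \<and> d \<noteq> 0)\<close> have "b = 0" by simp
      then have "(1 - \<alpha>) * ((a + d - real e) * \<alpha>) = (1 - \<alpha>) * d"
        using eig by (simp add: algebra_simps)
      then have *: "(a + d - real e) * \<alpha> = d"
        using \<alpha> by simp
      then have "a + d - real e = 0" by (rule irr) auto
      with * False show ?thesis by auto
    qed
    then have "f = id"
      using fixed_c_scalar_imp_id[OF \<alpha>(2,3) f(1) _ f(3)] inc by blast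
    with f(2) show False by contradiction
  qed
  moreover have "real_of_int (- int d) * (1 - \<alpha>)\<^sup>2 + real_of_int (int a - int e) * (1 - \<alpha>) * \<alpha>
      + real_of_int (int b) * \<alpha>\<^sup>2 = 0"
    using eig by (simp add: power2_eq_square algebra_simps)
  ultimately show ?thesis
    by (intro exI[of _ "- int d"] exI[of _ "int a - int e"] exI[of _ "int b"] conjI) auto
qed

section \<open>Periodicity of reduced quadratic forms\<close>

text \<open>
  The triple \<open>(p, r, q)\<close> stands for the form \<open>p u\<^sup>2 + r u v + q v\<^sup>2\<close>. The inequalities
  say that its two roots \<open>v / u\<close> have opposite signs.
\<close>

definition reduced_forms :: "int \<Rightarrow> (int \<times> int \<times> int) set" where
  "reduced_forms D = {(p, r, q). p < 0 \<and> 0 < q \<and> r\<^sup>2 - 4 * p * q = D}"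

definition form_root :: "int \<times> int \<times> int \<Rightarrow> real \<Rightarrow> real \<Rightarrow> bool" where
  "form_root = (\<lambda>(p, r, q) u v. 0 < u \<and> 0 < v \<and> p * u\<^sup>2 + r * u * v + q * v\<^sup>2 = 0)"

text \<open>
  One subtractive Euclidean step on the positive root: substitute \<open>v + u\<close> for \<open>v\<close> or
  \<open>u + v\<close> for \<open>u\<close>, according to whether the positive root \<open>v / u\<close> exceeds 1.
\<close>

definition form_step :: "int \<times> int \<times> int \<Rightarrow> int \<times> int \<times> int" where
  "form_step = (\<lambda>(p, r, q). if p + r + q < 0 then (p + r + q, r + 2 * q, q)
     else (p, r + 2 * p, p + r + q))"

text \<open>As \<open>p\<close> and \<open>q\<close> have opposite signs, \<open>D\<close> is the
  sum of the nonnegative terms \<open>r^2\<close> and \<open>4 * (- p * q)\<close>, which bounds all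
  entries.\<close>

lemma finite_reduced_forms: "finite (reduced_forms D)"
proof (rule finite_subset)
  show "reduced_forms D \<subseteq> {- D..0} \<times> {- D..D} \<times> {0..D}"
  proof
    fix x assume "x \<in> reduced_forms D"
    then obtain p r q where x: "x = (p, r, q)" and pq: "p < 0" "0 < q" "r\<^sup>2 - 4 * p * q = D"
      by (auto simp: reduced_forms_def)
    have "- p \<le> - p * q" "q \<le> - p * q"
      using pq mult_left_mono[of 1 q "- p"] mult_right_mono[of 1 "- p" q] by auto
    moreover have "\<bar>r\<bar> \<le> r\<^sup>2"
      using mult_left_mono[of 1 "\<bar>r\<bar>" "\<bar>r\<bar>"] by (cases "r = 0") (auto simp: power2_eq_square)
    moreover have "0 \<le> r\<^sup>2" by simp
    moreover have "D = r\<^sup>2 + 4 * (- p * q)" using pq by simp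
    ultimately have "- D \<le> p" "q \<le> D" "\<bar>r\<bar> \<le> D"
      using pq(1,2) by linarith+
    then show "x \<in> {- D..0} \<times> {- D..D} \<times> {0..D}"
      using pq x by auto
  qed
qed auto

text \<open>Both substitutions preserve the discriminant. The value \<open>p + r + q\<close> at
  \<open>(1, 1)\<close> is nonzero, since otherwise \<open>D = (p - q)^2\<close>, and its sign
  selects the branch that keeps the outer signs.\<close>

lemma form_step_reduced:
  assumes D: "\<And>k. D \<noteq> k\<^sup>2" and x: "x \<in> reduced_forms D"
  shows "form_step x \<in> reduced_forms D"
proof -
  obtain p r q where x: "x = (p, r, q)" and pq: "p < 0" "0 < q" "r\<^sup>2 - 4 * p * q = D"
    using x by (auto simp: reduced_forms_def)
  have "p + r + q \<noteq> 0"
  proof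
    assume "p + r + q = 0"
    then have "r = - p - q" by linarith
    have "D = (p - q)\<^sup>2"
      unfolding pq(3)[symmetric] \<open>r = - p - q\<close> by (simp add: power2_eq_square algebra_simps)
    with D show False by blast
  qed
  then show ?thesis
    using pq by (auto simp: x form_step_def reduced_forms_def power2_eq_square algebra_simps)
qed

text \<open>Each branch is invertible, and the result reveals the branch: its first minus middle
  plus last entry is the old \<open>p < 0\<close> in the first and the old \<open>q > 0\<close> in
  the second.\<close>

lemma inj_on_form_step: "inj_on form_step (reduced_forms D)"
  by (rule inj_onI) (auto simp: reduced_forms_def form_step_def split: if_splits)

lemma form_step_periodic:
  assumes D: "\<And>k. D \<noteq> k\<^sup>2" and x: "x \<in> reduced_forms D"
  shows "\<exists>n>0. (form_step ^^ n) x = x"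
proof -
  \<comment> \<open>Extension by the identity makes the map injective on all triples, as
    \<open>funpow_inj_finite\<close> requires.\<close>
  define T where "T y = (if y \<in> reduced_forms D then form_step y else y)" for y
  have "inj T"
    using inj_on_form_step[of D] form_step_reduced[OF D]
    by (auto simp: T_def inj_def inj_on_def) metis+
  have iter: "(T ^^ n) x = (form_step ^^ n) x \<and> (T ^^ n) x \<in> reduced_forms D" for n
    by (induction n) (use x form_step_reduced[OF D] in \<open>auto simp: T_def\<close>)
  then have "{y. \<exists>n. y = (T ^^ n) x} \<subseteq> reduced_forms D"
    by blast
  then have "finite {y. \<exists>n. y = (T ^^ n) x}"
    by (rule finite_subset) (rule finite_reduced_forms)
  with \<open>inj T\<close> obtain n where "n > 0" "(T ^^ n) x = x"
    by (rule funpow_inj_finite)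
  with iter show ?thesis by metis
qed

text \<open>The difference of the two equations, suitably scaled, is \<open>v * u' - v' * u\<close>
  times a cofactor, positive because \<open>r * u + q * v = - p * u^2 / v\<close>.\<close>

lemma form_root_unique:
  assumes "x \<in> reduced_forms D" "form_root x u v" "form_root x u' v'"
  shows "W u v = W u' v'"
proof -
  obtain p r q where x: "x = (p, r, q)" and pq: "p < 0" "0 < q"
    using assms(1) by (auto simp: reduced_forms_def)
  have pos: "0 < u" "0 < v" "0 < u'" "0 < v'"
    and eq: "p * u\<^sup>2 + r * u * v + q * v\<^sup>2 = 0" "p * u'\<^sup>2 + r * u' * v' + q * v'\<^sup>2 = 0"
    using assms by (auto simp: form_root_def x)
  have "v * (r * u + q * v) = - p * u\<^sup>2"
    using eq(1) by (simp add: power2_eq_square algebra_simps)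
  moreover have "- p * u\<^sup>2 > 0" using pq pos by (simp add: mult_neg_pos)
  ultimately have "r * u + q * v > 0"
    using pos by (metis zero_less_mult_pos)
  then have "r * u * u' + q * v * u' + q * v' * u > 0"
    using pos pq by (metis add_pos_pos distrib_right mult_pos_pos of_int_0_less_iff)
  moreover have "(v * u' - v' * u) * (r * u * u' + q * v * u' + q * v' * u) =
     (p * u\<^sup>2 + r * u * v + q * v\<^sup>2) * u'\<^sup>2 - (p * u'\<^sup>2 + r * u' * v' + q * v'\<^sup>2) * u\<^sup>2"
    by (simp add: power2_eq_square algebra_simps)
  ultimately have "v * u' = v' * u" using eq by simp
  then have "v / (u + v) = v' / (u' + v')"
    using pos by (simp add: field_simps)
  then show ?thesis by (simp add: W_def)
qed

text \<open>Each generator misses a one-letter word, so composing with it on the left cannot give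
  the identity.\<close>

lemma M38_comp_generator:
  assumes "\<psi> \<in> \<M>\<^sub>3\<^sub>8"
  shows "\<psi>\<^sub>3 \<circ> \<psi> \<in> \<M>\<^sub>3\<^sub>8" "\<psi>\<^sub>3 \<circ> \<psi> \<noteq> id" "\<psi>\<^sub>8 \<circ> \<psi> \<in> \<M>\<^sub>3\<^sub>8" "\<psi>\<^sub>8 \<circ> \<psi> \<noteq> id"
proof -
  show "\<psi>\<^sub>3 \<circ> \<psi> \<in> \<M>\<^sub>3\<^sub>8" "\<psi>\<^sub>8 \<circ> \<psi> \<in> \<M>\<^sub>3\<^sub>8"
    using assms unfolding \<M>\<^sub>3\<^sub>8_def by (auto intro: generated_monoid.intros)
  have "\<psi>\<^sub>3 w \<noteq> [One]" "\<psi>\<^sub>8 w \<noteq> [Zero]" for w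
    by (cases w; auto simp: \<psi>\<^sub>3_def \<psi>\<^sub>8_def subst_def split: letter.split)+
  then show "\<psi>\<^sub>3 \<circ> \<psi> \<noteq> id" "\<psi>\<^sub>8 \<circ> \<psi> \<noteq> id"
    by (metis comp_apply id_apply)+
qed

text \<open>The step subtracts one coordinate from the other, so the generator, which adds them,
  leads back from the new word to the old one.\<close>

lemma form_step_image:
  assumes "x \<in> reduced_forms D" "form_root x u v" "form_step x \<in> reduced_forms D"
  shows "\<exists>u' v'. form_root (form_step x) u' v' \<and>
    (is_image \<psi>\<^sub>3 (W u' v') (W u v) \<or> is_image \<psi>\<^sub>8 (W u' v') (W u v))"
proof -
  obtain p r q where x: "x = (p, r, q)" and pq: "p < 0" "0 < q"
    using assms(1) by (auto simp: reduced_forms_def)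
  have uv: "0 < u" "0 < v" and eq: "p * u\<^sup>2 + r * u * v + q * v\<^sup>2 = 0"
    using assms by (auto simp: form_root_def x)
  define w where "w = p + r + q"
  \<comment> \<open>The first factor on the right is negative, so the sign of \<open>w\<close> tells
    which coordinate is larger.\<close>
  have w: "real_of_int w * (u * v) = (p * u - q * v) * (v - u)"
    using eq by (simp add: w_def power2_eq_square algebra_simps)
  have "p * u < 0" "q * v > 0"
    using pq uv by (simp_all add: mult_neg_pos)
  then have neg: "p * u - q * v < 0" by linarith
  have "w \<noteq> 0"
    using assms(3) by (auto simp: x form_step_def reduced_forms_def w_def)
  then consider "w < 0" | "w > 0" by linarith
  then show ?thesis
  proof cases
    case 1
    then have "(p * u - q * v) * (v - u) < 0"
      unfolding w[symmetric] using uv by (simp add: mult_neg_pos)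
    then have "u < v"
      using neg by (simp add: mult_less_0_iff)
    moreover from this have "form_root (form_step x) u (v - u)"
      using 1 uv eq by (simp add: x form_step_def form_root_def w_def power2_eq_square algebra_simps)
    ultimately show ?thesis
      using is_image_psi8[of u "v - u"] uv by (metis add_diff_cancel_left' diff_gt_0_iff_gt diff_add_cancel add.commute)
  next
    case 2
    then have "(p * u - q * v) * (v - u) > 0"
      unfolding w[symmetric] using uv by simp
    then have "v < u"
      using neg by (simp add: zero_less_mult_iff)
    moreover from this have "form_root (form_step x) (u - v) v"
      using 2 uv eq by (simp add: x form_step_def form_root_def w_def power2_eq_square algebra_simps)
    ultimately show ?thesis
      using is_image_psi3[of "u - v" v] uv by (metis diff_gt_0_iff_gt diff_add_cancel)
  qed
qed

text \<open>Images run from the last direction back to the first, so the generator of the first step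
  is composed on the left of the product for the remaining steps.\<close>

lemma form_step_iterate_image:
  assumes D: "\<And>k. D \<noteq> k\<^sup>2"
  shows "x \<in> reduced_forms D \<Longrightarrow> form_root x u v \<Longrightarrow>
    \<exists>\<psi> u' v'. \<psi> \<in> \<M>\<^sub>3\<^sub>8 \<and> (n > 0 \<longrightarrow> \<psi> \<noteq> id) \<and> form_root ((form_step ^^ n) x) u' v' \<and>
      is_image \<psi> (W u' v') (W u v)"
proof (induction n arbitrary: x u v)
  case 0
  have "id \<in> \<M>\<^sub>3\<^sub>8" by (simp add: \<M>\<^sub>3\<^sub>8_def generated_monoid.id)
  with 0 is_image_id show ?case by (auto simp: funpow_0)
next
  case (Suc n)
  have step: "form_step x \<in> reduced_forms D"
    using form_step_reduced[OF D] Suc.prems(1) by blast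
  obtain u1 v1 where 1: "form_root (form_step x) u1 v1"
    "is_image \<psi>\<^sub>3 (W u1 v1) (W u v) \<or> is_image \<psi>\<^sub>8 (W u1 v1) (W u v)"
    using form_step_image[OF Suc.prems step] by blast
  obtain \<psi> u' v' where \<psi>: "\<psi> \<in> \<M>\<^sub>3\<^sub>8" "form_root ((form_step ^^ n) (form_step x)) u' v'"
    "is_image \<psi> (W u' v') (W u1 v1)"
    using Suc.IH[OF step 1(1)] by blast
  have "(form_step ^^ Suc n) x = (form_step ^^ n) (form_step x)"
    by (simp only: funpow_Suc_right comp_apply)
  with 1(2) \<psi> show ?case
    using M38_comp_generator[OF \<psi>(1)] is_image_comp[OF \<psi>(3)] by metis
qed

text \<open>After a period the form returns, and uniqueness of its positive root turns the image
  relation into a fixed word.\<close>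

lemma Sturm_number_fixed:
  assumes "Sturm_number \<alpha>"
  shows "\<exists>\<psi>\<in>\<M>\<^sub>3\<^sub>8. \<psi> \<noteq> id \<and> fixes_word \<psi> (s \<alpha> 0)"
proof -
  have \<alpha>: "\<alpha> \<notin> \<rat>" "0 < \<alpha>" "\<alpha> < 1"
    using assms by (auto simp: Sturm_number_def)
  obtain p r q :: int where pq: "p < 0" "0 < q"
    and eq: "p * (1 - \<alpha>)\<^sup>2 + r * (1 - \<alpha>) * \<alpha> + q * \<alpha>\<^sup>2 = 0"
    using Sturm_number_form[OF assms] by blast
  define D where "D = r\<^sup>2 - 4 * p * q"
  have D: "D \<noteq> k\<^sup>2" for k
  proof
    assume k: "D = k\<^sup>2"
    \<comment> \<open>\<open>t\<close> is a root of \<open>q * t^2 + r * t + p\<close>, so a square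
      \<open>D\<close> would make it, and then \<open>\<alpha>\<close>, rational.\<close>
    define t where "t = \<alpha> / (1 - \<alpha>)"
    have \<alpha>t: "t * (1 - \<alpha>) = \<alpha>" using \<alpha> by (simp add: t_def)
    have "(1 - \<alpha>)\<^sup>2 * (p + r * t + q * t\<^sup>2) =
        p * (1 - \<alpha>)\<^sup>2 + r * (1 - \<alpha>) * (t * (1 - \<alpha>)) + q * (t * (1 - \<alpha>))\<^sup>2"
      by (simp add: power2_eq_square algebra_simps)
    also have "\<dots> = 0"
      unfolding \<alpha>t by (rule eq)
    finally have root: "p + r * t + q * t\<^sup>2 = 0" using \<alpha> by simp
    have "(2 * q * t + r)\<^sup>2 = 4 * q * (p + r * t + q * t\<^sup>2) + (real_of_int r)\<^sup>2 - 4 * p * q"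
      by (simp add: power2_eq_square algebra_simps)
    also have "\<dots> = (real_of_int r)\<^sup>2 - 4 * p * q"
      unfolding root by simp
    also have "\<dots> = real_of_int (k\<^sup>2)"
      unfolding k[symmetric] by (simp add: D_def)
    finally have "(2 * q * t + r)\<^sup>2 = (real_of_int k)\<^sup>2" by simp
    then have "2 * q * t + r = k \<or> 2 * q * t + r = - k"
      by (simp add: power2_eq_iff)
    then have "t = (k - r) / (2 * q) \<or> t = (- k - r) / (2 * q)"
      using pq by (auto simp: field_simps)
    then have "t \<in> \<rat>" by auto
    moreover have "1 + t = 1 / (1 - \<alpha>)"
      using \<alpha> by (simp add: t_def field_simps)
    then have "\<alpha> = t / (1 + t)"
      using \<alpha> by (simp add: t_def)
    ultimately show False using \<alpha>(1) by simp
  qed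
  have x: "(p, r, q) \<in> reduced_forms D"
    using pq by (simp add: reduced_forms_def D_def)
  have root: "form_root (p, r, q) (1 - \<alpha>) \<alpha>"
    using \<alpha> eq by (simp add: form_root_def)
  obtain n where n: "n > 0" "(form_step ^^ n) (p, r, q) = (p, r, q)"
    using form_step_periodic[OF D x] by blast
  obtain \<psi> u v where \<psi>: "\<psi> \<in> \<M>\<^sub>3\<^sub>8" "\<psi> \<noteq> id" "form_root (p, r, q) u v"
    "is_image \<psi> (W u v) (W (1 - \<alpha>) \<alpha>)"
    using form_step_iterate_image[OF D x root, of n] n by auto
  have "W u v = W (1 - \<alpha>) \<alpha>"
    by (rule form_root_unique[OF x \<psi>(3) root])
  with \<psi> show ?thesis
    unfolding fixes_word_def W_slope by auto
qed

section \<open>Exchange of letters\<close>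

definition flip :: "letter \<Rightarrow> letter" where
  "flip = case_letter One Zero"

definition flip_conj :: "(letter list \<Rightarrow> letter list) \<Rightarrow> letter list \<Rightarrow> letter list" where
  "flip_conj f = map flip \<circ> f \<circ> map flip"

lemma flip_flip [simp]: "flip (flip x) = x"
  by (simp add: flip_def split: letter.split)

lemma flip_simps [simp]: "flip Zero = One" "flip One = Zero"
  by (simp_all add: flip_def)

lemma map_flip_flip [simp]: "map flip (map flip w) = w"
  by (induction w) simp_all

lemma flip_comp_flip [simp]: "flip \<circ> flip = id"
  by auto

lemma flip_conj_flip_conj [simp]: "flip_conj (flip_conj f) = f"
  by (auto simp: flip_conj_def)

lemma flip_conj_comp: "flip_conj (f \<circ> g) = flip_conj f \<circ> flip_conj g"
  by (auto simp: flip_conj_def)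

lemma flip_conj_id [simp]: "flip_conj id = id"
  by (auto simp: flip_conj_def)

lemma flip_conj_eq_id_iff [simp]: "flip_conj f = id \<longleftrightarrow> f = id"
  by (metis flip_conj_flip_conj flip_conj_id)

lemma flip_conj_funpow: "flip_conj (f ^^ n) = flip_conj f ^^ n"
  by (induction n) (simp_all only: funpow.simps flip_conj_id flip_conj_comp)

lemma flip_conj_generators: "flip_conj \<psi>\<^sub>3 = \<psi>\<^sub>7" "flip_conj \<psi>\<^sub>8 = \<psi>\<^sub>4"
proof -
  have "flip_conj \<psi>\<^sub>3 w = \<psi>\<^sub>7 w" "flip_conj \<psi>\<^sub>8 w = \<psi>\<^sub>4 w" for w
    by (induction w) (auto simp: flip_conj_def \<psi>\<^sub>3_def \<psi>\<^sub>4_def \<psi>\<^sub>7_def \<psi>\<^sub>8_def subst_def split: letter.split)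
  then show "flip_conj \<psi>\<^sub>3 = \<psi>\<^sub>7" "flip_conj \<psi>\<^sub>8 = \<psi>\<^sub>4" by auto
qed

lemma flip_conj_generators': "flip_conj \<psi>\<^sub>7 = \<psi>\<^sub>3" "flip_conj \<psi>\<^sub>4 = \<psi>\<^sub>8"
  by (simp_all flip: flip_conj_generators)

lemma flip_conj_generated_monoid:
  "f \<in> generated_monoid S \<Longrightarrow> flip_conj f \<in> generated_monoid (flip_conj ` S)"
proof (induction rule: generated_monoid.induct)
  case id
  show ?case unfolding flip_conj_id by (rule generated_monoid.id)
next
  case (gen f)
  then show ?case by (intro generated_monoid.gen imageI)
next
  case (comp f g)
  from comp.IH show ?case unfolding flip_conj_comp by (rule generated_monoid.comp)
qed

lemma flip_conj_M38: "f \<in> \<M>\<^sub>3\<^sub>8 \<Longrightarrow> flip_conj f \<in> \<M>\<^sub>4\<^sub>7"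
  using flip_conj_generated_monoid[of f "{\<psi>\<^sub>3, \<psi>\<^sub>8}"]
  by (simp add: \<M>\<^sub>3\<^sub>8_def \<M>\<^sub>4\<^sub>7_def flip_conj_generators insert_commute)

lemma flip_conj_M47: "f \<in> \<M>\<^sub>4\<^sub>7 \<Longrightarrow> flip_conj f \<in> \<M>\<^sub>3\<^sub>8"
  using flip_conj_generated_monoid[of f "{\<psi>\<^sub>4, \<psi>\<^sub>7}"]
  by (simp add: \<M>\<^sub>3\<^sub>8_def \<M>\<^sub>4\<^sub>7_def flip_conj_generators' insert_commute)

lemma flip_conj_M3: "f \<in> \<M>\<^sub>3 \<Longrightarrow> flip_conj f \<in> \<M>\<^sub>7"
  by (auto simp: \<M>\<^sub>3_def \<M>\<^sub>7_def flip_conj_funpow flip_conj_generators)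

lemma flip_conj_M8: "f \<in> \<M>\<^sub>8 \<Longrightarrow> flip_conj f \<in> \<M>\<^sub>4"
  by (auto simp: \<M>\<^sub>8_def \<M>\<^sub>4_def flip_conj_funpow flip_conj_generators)

lemma morphism_flip_conj: "morphism f \<Longrightarrow> morphism (flip_conj f)"
  by (simp add: morphism_def flip_conj_def)

lemma fixes_word_flip_conj:
  assumes "fixes_word f x"
  shows "fixes_word (flip_conj f) (flip \<circ> x)"
proof -
  have prefix: "prefix n (flip \<circ> x) = map flip (prefix n x)" for n
    by (simp add: subsequence_def)
  have image: "flip_conj f (map flip w) = map flip (f w)" for w
    by (simp only: flip_conj_def map_flip_flip comp_apply)
  have "\<exists>m. map flip (f (prefix n x)) = map flip (prefix m x)" for n
  proof -
    obtain m where "f (prefix n x) = prefix m x"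
      using assms unfolding fixes_word_def is_image_def by blast
    then show ?thesis by metis
  qed
  moreover have "filterlim (\<lambda>n. length (f (prefix n x))) at_top sequentially"
    using assms unfolding fixes_word_def is_image_def by (rule conjunct2)
  ultimately show ?thesis
    unfolding fixes_word_def is_image_def prefix image length_map by blast
qed

lemma flip_letter_of_int: "k \<in> {0, 1} \<Longrightarrow> letter_of_int (1 - k) = flip (letter_of_int k)"
  by auto

text \<open>Subtraction from the integer \<open>m\<close> turns ceilings for \<open>\<alpha>\<close>
  into floors for \<open>1 - \<alpha>\<close>.\<close>

lemma s'_eq_flip_s:
  assumes "0 < \<alpha>" "\<alpha> < 1"
  shows "s' \<alpha> 0 = flip \<circ> s (1 - \<alpha>) 0"
proof
  fix n
  have ceil: "\<lceil>real m * \<alpha> + 0\<rceil> = int m - \<lfloor>real m * (1 - \<alpha>) + 0\<rfloor>" for m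
  proof -
    have "real m * \<alpha> + 0 = real m - (real m * (1 - \<alpha>) + 0)"
      by (simp add: algebra_simps)
    then show ?thesis by linarith
  qed
  have "s' \<alpha> 0 n = letter_of_int (1 - (\<lfloor>real (n + 1) * (1 - \<alpha>) + 0\<rfloor> - \<lfloor>real n * (1 - \<alpha>) + 0\<rfloor>))"
    unfolding s'_def ceil by (simp add: algebra_simps)
  also have "\<dots> = (flip \<circ> s (1 - \<alpha>) 0) n"
    using flip_letter_of_int[OF floor_diff[of "1 - \<alpha>" n 0]] assms by (simp add: s_def)
  finally show "s' \<alpha> 0 n = (flip \<circ> s (1 - \<alpha>) 0) n" .
qed

text \<open>By irrationality \<open>(m + 1) * \<alpha>\<close> is never an integer, so the floor of
  \<open>m + 1\<close> minus it is exactly \<open>m\<close> minus its floor.\<close>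

lemma c_flip:
  assumes "\<alpha> \<notin> \<rat>" "0 < \<alpha>" "\<alpha> < 1"
  shows "c (1 - \<alpha>) = flip \<circ> c \<alpha>"
proof
  fix n
  have floor: "\<lfloor>real m * (1 - \<alpha>) + (1 - \<alpha>)\<rfloor> = int m - \<lfloor>real m * \<alpha> + \<alpha>\<rfloor>" for m
  proof -
    have "real m * \<alpha> + \<alpha> \<noteq> of_int \<lfloor>real m * \<alpha> + \<alpha>\<rfloor>"
    proof
      assume "real m * \<alpha> + \<alpha> = of_int \<lfloor>real m * \<alpha> + \<alpha>\<rfloor>"
      then have "\<alpha> = of_int \<lfloor>real m * \<alpha> + \<alpha>\<rfloor> / real (Suc m)"
        by (simp add: field_simps)
      also have "\<dots> \<in> \<rat>" by simp
      finally show False using assms(1) by simp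
    qed
    moreover have "real m * (1 - \<alpha>) + (1 - \<alpha>) = real m + 1 - (real m * \<alpha> + \<alpha>)"
      by (simp add: algebra_simps)
    ultimately show ?thesis by linarith
  qed
  have "c (1 - \<alpha>) n = letter_of_int (1 - (\<lfloor>real (n + 1) * \<alpha> + \<alpha>\<rfloor> - \<lfloor>real n * \<alpha> + \<alpha>\<rfloor>))"
    unfolding c_def s_def floor by (simp add: algebra_simps)
  also have "\<dots> = (flip \<circ> c \<alpha>) n"
    using flip_letter_of_int[OF floor_diff[of \<alpha> n \<alpha>]] assms by (simp add: c_def s_def)
  finally show "c (1 - \<alpha>) n = (flip \<circ> c \<alpha>) n" .
qed

lemma Sturm_number_flip:
  assumes "Sturm_number \<alpha>"
  shows "Sturm_number (1 - \<alpha>)"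
proof -
  obtain f where \<alpha>: "\<alpha> \<notin> \<rat>" "0 < \<alpha>" "\<alpha> < 1"
    and f: "morphism f" "f \<noteq> id" "fixes_word f (c \<alpha>)"
    using assms unfolding Sturm_number_def by blast
  have "1 - \<alpha> \<notin> \<rat>"
    using \<alpha>(1) Rats_diff[OF Rats_1, of "1 - \<alpha>"] by auto
  moreover have "fixes_word (flip_conj f) (c (1 - \<alpha>))"
    unfolding c_flip[OF \<alpha>] by (rule fixes_word_flip_conj[OF f(3)])
  ultimately show ?thesis
    unfolding Sturm_number_def using \<alpha>(2,3) f(2) morphism_flip_conj[OF f(1)]
    by (intro conjI exI[of _ "flip_conj f"]) auto
qed

text \<open>The identity lies in both monoids and fixes every word, hence the demand
  \<open>\<psi> \<noteq> id\<close>.\<close>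

theorem theorem3:
  shows "(\<forall>\<alpha>. Sturm_number \<alpha> \<longrightarrow> (\<exists>\<psi>\<in>\<M>\<^sub>3\<^sub>8. \<psi> \<noteq> id \<and> fixes_word \<psi> (s \<alpha> 0))) \<and>
         (\<forall>\<psi>\<in>\<M>\<^sub>3\<^sub>8 - (\<M>\<^sub>3 \<union> \<M>\<^sub>8). \<exists>\<alpha>. Sturm_number \<alpha> \<and> fixes_word \<psi> (s \<alpha> 0)) \<and>
         (\<forall>\<alpha>. Sturm_number \<alpha> \<longrightarrow> (\<exists>\<psi>\<in>\<M>\<^sub>4\<^sub>7. \<psi> \<noteq> id \<and> fixes_word \<psi> (s' \<alpha> 0))) \<and>
         (\<forall>\<psi>\<in>\<M>\<^sub>4\<^sub>7 - (\<M>\<^sub>4 \<union> \<M>\<^sub>7). \<exists>\<alpha>. Sturm_number \<alpha> \<and> fixes_word \<psi> (s' \<alpha> 0))"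
proof (intro conjI allI ballI impI)
  fix \<alpha> assume "Sturm_number \<alpha>"
  then show "\<exists>\<psi>\<in>\<M>\<^sub>3\<^sub>8. \<psi> \<noteq> id \<and> fixes_word \<psi> (s \<alpha> 0)"
    by (rule Sturm_number_fixed)
next
  fix \<psi> assume "\<psi> \<in> \<M>\<^sub>3\<^sub>8 - (\<M>\<^sub>3 \<union> \<M>\<^sub>8)"
  then show "\<exists>\<alpha>. Sturm_number \<alpha> \<and> fixes_word \<psi> (s \<alpha> 0)"
    by (rule M38_fixes)
next
  fix \<alpha> assume \<alpha>: "Sturm_number \<alpha>"
  obtain \<psi> where \<psi>: "\<psi> \<in> \<M>\<^sub>3\<^sub>8" "\<psi> \<noteq> id" "fixes_word \<psi> (s (1 - \<alpha>) 0)"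
    using Sturm_number_fixed[OF Sturm_number_flip[OF \<alpha>]] by blast
  have "fixes_word (flip_conj \<psi>) (s' \<alpha> 0)"
    using fixes_word_flip_conj[OF \<psi>(3)] \<alpha> s'_eq_flip_s by (simp add: Sturm_number_def)
  moreover have "flip_conj \<psi> \<noteq> id"
    using \<psi>(2) by simp
  ultimately show "\<exists>\<psi>\<in>\<M>\<^sub>4\<^sub>7. \<psi> \<noteq> id \<and> fixes_word \<psi> (s' \<alpha> 0)"
    using flip_conj_M38[OF \<psi>(1)] by (intro bexI conjI)
next
  fix \<psi> assume \<psi>: "\<psi> \<in> \<M>\<^sub>4\<^sub>7 - (\<M>\<^sub>4 \<union> \<M>\<^sub>7)"
  then have conj: "flip_conj \<psi> \<in> \<M>\<^sub>3\<^sub>8 - (\<M>\<^sub>3 \<union> \<M>\<^sub>8)"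
    using flip_conj_M47[of \<psi>] flip_conj_M3[of "flip_conj \<psi>"] flip_conj_M8[of "flip_conj \<psi>"]
    by (simp only: flip_conj_flip_conj Diff_iff Un_iff) iprover
  obtain \<alpha> where \<alpha>: "Sturm_number \<alpha>" "fixes_word (flip_conj \<psi>) (s \<alpha> 0)"
    using M38_fixes[OF conj] by blast
  have "fixes_word \<psi> (s' (1 - \<alpha>) 0)"
    using fixes_word_flip_conj[OF \<alpha>(2)] \<alpha>(1) s'_eq_flip_s[of "1 - \<alpha>"]
    by (simp add: Sturm_number_def)
  with Sturm_number_flip[OF \<alpha>(1)] show "\<exists>\<alpha>. Sturm_number \<alpha> \<and> fixes_word \<psi> (s' \<alpha> 0)"
    by (intro exI conjI)
qed

end
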